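(* Let $G$ be a finite simple bipartite graph. The following are equivalent: (i) there exists a maximum stable set $S$ of $G$ having an accessibility chain; (ii) there exists a uniquely restricted maximum matching in $G$; (iii) every maximum stable set $S$ of $G$ has an accessibility chain.
   Context: For $A\subseteq V(G)$, $N(A)=\{v\in V(G)-A: v \text{ has a neighbor in } A\}$ and $N[A]=A\cup N(A)$; $G[X]$ is the induced subgraph on $X$. A stable set is a set of pairwise non-adjacent vertices; a maximum stable set is one of maximum cardinality. A set $A$ is a local maximum stable set of $G$ if $A$ is a maximum stable set of $G[N[A]]$; $\Psi(G)$ is the family of all such sets. For a set $S=\{x_1,\dots,x_k\}$, an accessibility chain for $S$ is an ordering of its elements such that $\{x_1,\dots,x_j\}\in\Psi(G)$ for every $j\in\{1,\dots,k\}$, i.e. a chain $\{x_1\}\subset\{x_1,x_2\}\subset\cdots\subset\{x_1,\dots,x_k\}=S$ of local maximum stable sets. A matching $M$ is uniquely restricted if $M$ is the unique perfect matching of the subgraph induced by the vertices saturated by $M$. *)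

theory Defs
  imports "Graph_Theory.Digraph_Component"
begin

text \<open>
  A finite simple graph is a \<^locale>\<open>graph\<close>: a finite symmetric digraph without loops and without
  parallel arcs, in which an undirected edge is a pair of opposite arcs. For matchings, which are
  sets of undirected edges, such a pair is identified with the set of its two ends.
\<close>

definition uedges :: "('a, 'b) pre_digraph \<Rightarrow> 'a set set" where
  "uedges G = {{u, v} | u v. u \<rightarrow>\<^bsub>G\<^esub> v}"

definition bipartite :: "('a, 'b) pre_digraph \<Rightarrow> bool" where
  "bipartite G \<longleftrightarrow> (\<exists>U W. verts G = U \<union> W \<and> U \<inter> W = {} \<and>
     (\<forall>u v. u \<rightarrow>\<^bsub>G\<^esub> v \<longrightarrow> u \<in> U \<and> v \<in> W \<or> u \<in> W \<and> v \<in> U))"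

definition nbhd :: "('a, 'b) pre_digraph \<Rightarrow> 'a set \<Rightarrow> 'a set" where
  "nbhd G A = {v \<in> verts G - A. \<exists>u\<in>A. u \<rightarrow>\<^bsub>G\<^esub> v}"

definition closed_nbhd :: "('a, 'b) pre_digraph \<Rightarrow> 'a set \<Rightarrow> 'a set" where
  "closed_nbhd G A = A \<union> nbhd G A"

definition stable_set :: "('a, 'b) pre_digraph \<Rightarrow> 'a set \<Rightarrow> bool" where
  "stable_set G S \<longleftrightarrow> S \<subseteq> verts G \<and> pairwise (\<lambda>u v. \<not> u \<rightarrow>\<^bsub>G\<^esub> v) S"

definition maximum_stable_set :: "('a, 'b) pre_digraph \<Rightarrow> 'a set \<Rightarrow> bool" where
  "maximum_stable_set G S \<longleftrightarrow>
     stable_set G S \<and> (\<forall>T. stable_set G T \<longrightarrow> card T \<le> card S)"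

text \<open>
  The condition \<open>A \<subseteq> verts G\<close> is not redundant: \<open>G \<restriction> X\<close> has vertex set \<open>X\<close> even if \<open>X\<close> is not
  contained in \<open>verts G\<close>.
\<close>

definition local_maximum_stable_sets :: "('a, 'b) pre_digraph \<Rightarrow> 'a set set" (\<open>\<Psi>\<close>) where
  "\<Psi> G = {A. A \<subseteq> verts G \<and> maximum_stable_set (G \<restriction> closed_nbhd G A) A}"

definition accessibility_chain :: "('a, 'b) pre_digraph \<Rightarrow> 'a set \<Rightarrow> 'a list \<Rightarrow> bool" where
  "accessibility_chain G S xs \<longleftrightarrow>
     distinct xs \<and> set xs = S \<and> (\<forall>j\<in>{1..length xs}. set (take j xs) \<in> \<Psi> G)"

definition matching :: "('a, 'b) pre_digraph \<Rightarrow> 'a set set \<Rightarrow> bool" where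
  "matching G M \<longleftrightarrow> M \<subseteq> uedges G \<and> pairwise disjnt M"

definition maximum_matching :: "('a, 'b) pre_digraph \<Rightarrow> 'a set set \<Rightarrow> bool" where
  "maximum_matching G M \<longleftrightarrow>
     matching G M \<and> (\<forall>M'. matching G M' \<longrightarrow> card M' \<le> card M)"

definition perfect_matching :: "('a, 'b) pre_digraph \<Rightarrow> 'a set set \<Rightarrow> bool" where
  "perfect_matching G M \<longleftrightarrow> matching G M \<and> \<Union>M = verts G"

text \<open>The set of vertices saturated by \<open>M\<close> is \<open>\<Union>M\<close>.\<close>

definition uniquely_restricted :: "('a, 'b) pre_digraph \<Rightarrow> 'a set set \<Rightarrow> bool" where
  "uniquely_restricted G M \<longleftrightarrow> matching G M \<and> perfect_matching (G \<restriction> \<Union>M) M \<and>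
     (\<forall>M'. perfect_matching (G \<restriction> \<Union>M) M' \<longrightarrow> M' = M)"

end

theory Submission
  imports Defs
begin

text \<open>
  For a maximum stable set \<open>S\<close> of a bipartite graph, the maximum matchings are, by Koenig's theorem,
  exactly the injections \<open>p\<close> from the complement \<open>Y\<close> of \<open>S\<close> into \<open>S\<close> along edges.

  An accessibility chain of \<open>S\<close> adds at most one new neighbour with each vertex (otherwise the new
  neighbours, which are stable because they lie on one side of the bipartition, would beat it), and
  matching each \<open>y\<close> with the first vertex of the chain adjacent to it yields such a \<open>p\<close>. Any other
  perfect matching of the saturated vertices agrees with \<open>p\<close> by induction along the chain.

  Conversely, a subset \<open>A\<close> of \<open>S\<close> is a local maximum stable set as soon as \<open>p\<close> maps the neighbours
  of \<open>A\<close> into \<open>A\<close>. An ordering of \<open>S\<close> with all initial segments closed in this sense exists unless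
  the relation "\<open>x\<close> has a neighbour \<open>y\<close> with \<open>p y = x'\<close> and \<open>x' \<noteq> x\<close>" has a cycle; rotating
  \<open>p\<close> along such a cycle produces a second perfect matching of the same vertices.
\<close>

section \<open>Finite sets\<close>

text \<open>Iterating \<open>f\<close> shrinks \<open>C\<close> until the image stops getting
  smaller. On the resulting finite \<open>D\<close> the map is a permutation, so \<open>D\<close>
  consists of cycles of \<open>f\<close>.\<close>

lemma finite_invariant_subset:
  assumes "finite C" "C \<noteq> {}" "f ` C \<subseteq> C"
  obtains D where "D \<subseteq> C" "D \<noteq> {}" "f ` D = D"
proof -
  from assms have "\<exists>D. D \<subseteq> C \<and> D \<noteq> {} \<and> f ` D = D"
  proof (induction C rule: finite_psubset_induct)
    case (psubset C)
    show ?case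
    proof (cases "f ` C = C")
      case True
      with psubset.prems show ?thesis by blast
    next
      case False
      then have lt: "f ` C \<subset> C" using psubset.prems by blast
      moreover have "f ` C \<noteq> {}" "f ` f ` C \<subseteq> f ` C" using psubset.prems by auto
      ultimately obtain D where "D \<subseteq> f ` C" "D \<noteq> {}" "f ` D = D"
        using psubset.IH by metis
      then show ?thesis using lt by (meson psubset_imp_subset subset_trans)
    qed
  qed
  then show ?thesis using that by metis
qed

text \<open>A greedy topological sort in which loops of \<open>r\<close> are harmless:
  \<open>step\<close>, applied to the elements not yet listed, yields one whose
  \<open>r\<close>-successors are listed already or equal to it.\<close>

lemma closed_prefix_ordering:
  assumes "finite S"
    and step: "\<And>C. C \<subseteq> S \<Longrightarrow> C \<noteq> {} \<Longrightarrow> \<exists>x\<in>C. \<forall>y. r x y \<longrightarrow> y \<in> insert x (S - C)"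
  shows "\<exists>xs. distinct xs \<and> set xs = S \<and>
    (\<forall>j. \<forall>x\<in>set (take j xs). \<forall>y. r x y \<longrightarrow> y \<in> set (take j xs))"
proof -
  let ?closed = "\<lambda>A. \<forall>x\<in>A. \<forall>y. r x y \<longrightarrow> y \<in> A"
  have "\<exists>xs. distinct xs \<and> set xs \<subseteq> S \<and> length xs = k \<and> (\<forall>j. ?closed (set (take j xs)))"
    if "k \<le> card S" for k
    using that
  proof (induction k)
    case 0
    show ?case by (rule exI[of _ "[]"]) simp
  next
    case (Suc k)
    then obtain xs where xs: "distinct xs" "set xs \<subseteq> S" "length xs = k"
      "\<And>j. ?closed (set (take j xs))"
      by auto
    have "card (set xs) < card S" using xs Suc.prems distinct_card by fastforce
    then have "S - set xs \<noteq> {}" using xs(2) by auto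
    then obtain x where x: "x \<in> S - set xs" "\<forall>y. r x y \<longrightarrow> y \<in> insert x (S - (S - set xs))"
      using step[of "S - set xs"] by blast
    have "?closed (set (take j (xs @ [x])))" for j
    proof (cases "j \<le> length xs")
      case True
      then show ?thesis using xs(4)[of j] by simp
    next
      case False
      then show ?thesis using xs(4)[of "length xs"] x by auto
    qed
    then show ?case using xs x by (intro exI[of _ "xs @ [x]"]) auto
  qed
  from this[of "card S"] obtain xs where "distinct xs" "set xs \<subseteq> S" "length xs = card S"
    "\<forall>j. ?closed (set (take j xs))"
    by auto
  moreover from this have "set xs = S"
    using assms(1) by (intro card_subset_eq) (auto simp: distinct_card)
  ultimately show ?thesis by (intro exI[of _ xs] conjI)
qed

section \<open>Matchings as injections\<close>

text \<open>As a function on the saturated side, a matching is rotated or augmented by a mere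
  function update. Disjointness of \<open>Y\<close> and \<open>S\<close> is left to the lemmas that
  pass to sets of edges.\<close>

definition matches_into :: "('a, 'b) pre_digraph \<Rightarrow> ('a \<Rightarrow> 'a) \<Rightarrow> 'a set \<Rightarrow> 'a set \<Rightarrow> bool" where
  "matches_into G p Y S \<longleftrightarrow> inj_on p Y \<and> p ` Y \<subseteq> S \<and> (\<forall>y\<in>Y. y \<rightarrow>\<^bsub>G\<^esub> p y)"

abbreviation edges_of :: "('a \<Rightarrow> 'a) \<Rightarrow> 'a set \<Rightarrow> 'a set set" where
  "edges_of p Y \<equiv> (\<lambda>y. {y, p y}) ` Y"

lemma matching_edges_of:
  assumes "matches_into G p Y S" "Y \<inter> S = {}"
  shows "matching G (edges_of p Y)" "card (edges_of p Y) = card Y"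
proof -
  have inj: "inj_on p Y" and S: "\<And>y. y \<in> Y \<Longrightarrow> p y \<in> S" and adj: "\<And>y. y \<in> Y \<Longrightarrow> y \<rightarrow>\<^bsub>G\<^esub> p y"
    using assms(1) by (auto simp: matches_into_def)
  have "edges_of p Y \<subseteq> uedges G" using adj by (auto simp: uedges_def)
  moreover have "pairwise disjnt (edges_of p Y)"
    using S assms(2) inj by (fastforce simp: pairwise_def disjnt_def dest: inj_onD)
  ultimately show "matching G (edges_of p Y)" by (simp add: matching_def)
  have "inj_on (\<lambda>y. {y, p y}) Y"
    using S assms(2) by (fastforce simp: inj_on_def doubleton_eq_iff)
  then show "card (edges_of p Y) = card Y" by (rule card_image)
qed

lemma Union_edges_of: "\<Union>(edges_of p Y) = Y \<union> p ` Y"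
  by auto

lemma matching_same_edge:
  assumes "matching G M" "e \<in> M" "e' \<in> M" "v \<in> e" "v \<in> e'"
  shows "e = e'"
  using assms unfolding matching_def pairwise_def disjnt_def by blast

lemma dominates_induce_subgraph_iff:
  "u \<rightarrow>\<^bsub>G \<restriction> X\<^esub> v \<longleftrightarrow> u \<rightarrow>\<^bsub>G\<^esub> v \<and> u \<in> X \<and> v \<in> X"
  by (auto simp: arcs_ends_def arc_to_ends_def)

lemma perfect_matching_induce_subgraph_iff:
  "perfect_matching (G \<restriction> X) M \<longleftrightarrow> matching G M \<and> \<Union>M = X"
proof -
  have "uedges (G \<restriction> X) = {e \<in> uedges G. e \<subseteq> X}"
    unfolding uedges_def dominates_induce_subgraph_iff by auto
  then show ?thesis by (auto simp: perfect_matching_def matching_def)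
qed

text \<open>Removes the induced subgraph: a rival is any matching of \<open>G\<close> saturating the
  same vertices, since its edges lie inside that vertex set anyway.\<close>

lemma uniquely_restricted_iff:
  "uniquely_restricted G M \<longleftrightarrow>
    matching G M \<and> (\<forall>M'. matching G M' \<and> \<Union>M' = \<Union>M \<longrightarrow> M' = M)"
  by (auto simp: uniquely_restricted_def perfect_matching_induce_subgraph_iff)

context graph
begin

lemma dominates_sym: "u \<rightarrow> v \<Longrightarrow> v \<rightarrow> u"
  using sym_arcs by (rule arcs_ends_symmetric)

lemma dominates_neq: "u \<rightarrow> v \<Longrightarrow> u \<noteq> v"
  using adj_not_same by blast

lemma uedges_iff: "{u, v} \<in> uedges G \<longleftrightarrow> u \<rightarrow> v"
  by (auto simp: uedges_def doubleton_eq_iff intro: dominates_sym)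

text \<open>The converse of \<open>matching_edges_of\<close>. Edges sharing an end coincide, which
  makes the chosen partners injective, and disjointness of \<open>Y\<close> and \<open>S\<close>
  tells the two ends of an edge apart.\<close>

lemma matching_eq_edges_of:
  assumes M: "matching G M"
    and ends: "\<And>e. e \<in> M \<Longrightarrow> \<exists>y s. e = {y, s} \<and> y \<in> Y \<and> s \<in> S"
    and disj: "Y \<inter> S = {}" and sat: "Y \<subseteq> \<Union>M"
  obtains p where "matches_into G p Y S" "M = edges_of p Y"
proof -
  have "\<forall>y\<in>Y. \<exists>s. s \<in> S \<and> {y, s} \<in> M"
  proof
    fix y assume y: "y \<in> Y"
    then obtain e where e: "e \<in> M" "y \<in> e" using sat by blast
    then obtain y' s where s: "e = {y', s}" "y' \<in> Y" "s \<in> S" using ends by blast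
    then have "y = y'" using y e disj by blast
    then show "\<exists>s. s \<in> S \<and> {y, s} \<in> M" using e s by blast
  qed
  then obtain p where p: "\<And>y. y \<in> Y \<Longrightarrow> p y \<in> S" "\<And>y. y \<in> Y \<Longrightarrow> {y, p y} \<in> M"
    by metis
  have "inj_on p Y"
  proof
    fix y y' assume y: "y \<in> Y" "y' \<in> Y" "p y = p y'"
    then have "{y, p y} = {y', p y'}"
      using matching_same_edge[OF M p(2)[of y] p(2)[of y'], of "p y"] by simp
    then show "y = y'" using y p disj by (auto simp: doubleton_eq_iff)
  qed
  moreover have "y \<rightarrow> p y" if "y \<in> Y" for y
    using p(2)[OF that] M uedges_iff by (auto simp: matching_def)
  ultimately have "matches_into G p Y S" using p(1) by (auto simp: matches_into_def)
  moreover have "e \<in> edges_of p Y" if e: "e \<in> M" for e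
  proof -
    obtain y where y: "y \<in> e" "y \<in> Y" using ends[OF e] by blast
    then have "e = {y, p y}" using matching_same_edge[OF M e p(2)] by simp
    then show ?thesis using y by blast
  qed
  ultimately show ?thesis using p(2) that[of p] by blast
qed

section \<open>Stable sets and the bound they put on matchings\<close>

lemma stable_setD: "stable_set G S \<Longrightarrow> u \<in> S \<Longrightarrow> v \<in> S \<Longrightarrow> \<not> u \<rightarrow> v"
  using dominates_neq[of u v] by (auto simp: stable_set_def pairwise_def)

lemma stable_setI: "S \<subseteq> verts G \<Longrightarrow> (\<And>u v. u \<in> S \<Longrightarrow> v \<in> S \<Longrightarrow> \<not> u \<rightarrow> v) \<Longrightarrow> stable_set G S"
  by (auto simp: stable_set_def pairwise_def)

lemma stable_set_induce_subgraphI: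
  "S \<subseteq> X \<Longrightarrow> (\<And>u v. u \<in> S \<Longrightarrow> v \<in> S \<Longrightarrow> \<not> u \<rightarrow> v) \<Longrightarrow> stable_set (G \<restriction> X) S"
  by (auto simp: stable_set_def pairwise_def dominates_induce_subgraph_iff)

lemma stable_set_induce_subgraphD:
  assumes "stable_set (G \<restriction> X) T"
  shows "T \<subseteq> X" "u \<in> T \<Longrightarrow> v \<in> T \<Longrightarrow> \<not> u \<rightarrow> v"
proof -
  show X: "T \<subseteq> X" using assms by (simp add: stable_set_def)
  show "\<not> u \<rightarrow> v" if "u \<in> T" "v \<in> T"
    using assms that X dominates_neq[of u v]
    by (auto simp: stable_set_def pairwise_def dominates_induce_subgraph_iff)
qed

text \<open>The complement of a stable set is a vertex cover, and disjoint edges cannot share a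
  chosen end. This gives the easy inequality of Koenig's theorem.\<close>

lemma choose_end_outside_stable:
  assumes "stable_set G S" "matching G M"
  obtains g where "\<And>e. e \<in> M \<Longrightarrow> g e \<in> e" "inj_on g M" "g ` M \<subseteq> verts G - S"
proof -
  have "\<forall>e\<in>M. \<exists>v. v \<in> e \<and> v \<in> verts G - S"
  proof
    fix e assume "e \<in> M"
    then obtain u v where uv: "e = {u, v}" "u \<rightarrow> v"
      using assms(2) by (auto simp: matching_def uedges_def)
    then have "u \<notin> S \<or> v \<notin> S" using stable_setD[OF assms(1)] by blast
    then show "\<exists>v. v \<in> e \<and> v \<in> verts G - S" using uv adj_in_verts by blast
  qed
  then obtain g where g: "\<And>e. e \<in> M \<Longrightarrow> g e \<in> e" "\<And>e. e \<in> M \<Longrightarrow> g e \<in> verts G - S"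
    by metis
  moreover have "inj_on g M"
    using g(1) matching_same_edge[OF assms(2)] by (intro inj_onI) metis
  ultimately show ?thesis using that[of g] by blast
qed

lemma card_matching_le:
  assumes "stable_set G S" "matching G M"
  shows "card M \<le> card (verts G - S)"
proof -
  obtain g where "inj_on g M" "g ` M \<subseteq> verts G - S"
    using choose_end_outside_stable[OF assms] by metis
  then show ?thesis by (intro card_inj_on_le[of g]) auto
qed

section \<open>Koenig's theorem\<close>

text \<open>The matchings obtained from \<open>m\<close> along alternating paths that start in an unsaturated
  vertex of \<open>U\<close>; all of them saturate the same vertices \<open>W'\<close> of the other side.\<close>

inductive rotation :: "'a set \<Rightarrow> 'a set \<Rightarrow> ('a \<Rightarrow> 'a) \<Rightarrow> ('a \<Rightarrow> 'a) \<Rightarrow> bool"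
  for U W' m where
  refl: "rotation U W' m m"
| step: "rotation U W' m m1 \<Longrightarrow> u \<in> U - m1 ` W' \<Longrightarrow> w \<in> W' \<Longrightarrow> w \<rightarrow> u \<Longrightarrow>
    rotation U W' m (m1(w := u))"

text \<open>Two moves in one: for \<open>w\<close> in \<open>W'\<close> the matching is rotated at
  \<open>w\<close>, for \<open>w\<close> outside \<open>W'\<close> it is augmented.\<close>

lemma matches_into_fun_upd:
  assumes "matches_into G m W' U" "u \<in> U - m ` W'" "w \<rightarrow> u"
  shows "matches_into G (m(w := u)) (insert w W') U"
proof -
  have "inj_on (m(w := u)) (insert w W')"
    using assms by (auto simp: matches_into_def inj_on_def)
  then show ?thesis using assms by (auto simp: matches_into_def)
qed

text \<open>Let \<open>R\<close> be the vertices of \<open>U\<close> left free by some rotation and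
  \<open>N\<close> their neighbours in \<open>W\<close>. Without augmentation, \<open>N\<close> is
  matched into \<open>R\<close> by \<open>m\<close>, so \<open>R\<close> contains the free vertices
  of \<open>U\<close> and \<open>card N\<close> further ones. This makes the stable set of
  \<open>R\<close> and \<open>W - N\<close> large enough.\<close>

lemma koenig_bipartition:
  assumes U: "U \<subseteq> verts G" and W: "W \<subseteq> verts G" and "U \<inter> W = {}"
    and stableU: "\<And>u v. u \<in> U \<Longrightarrow> v \<in> U \<Longrightarrow> \<not> u \<rightarrow> v"
    and stableW: "\<And>u v. u \<in> W \<Longrightarrow> v \<in> W \<Longrightarrow> \<not> u \<rightarrow> v"
    and W': "W' \<subseteq> W" and m: "matches_into G m W' U"
    and maximal: "\<And>m' w. w \<in> W - W' \<Longrightarrow> \<not> matches_into G m' (insert w W') U"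
  shows "\<exists>T. stable_set G T \<and> card U + card W \<le> card T + card W'"
proof -
  have fin: "finite U" "finite W" using U W by (auto intro: finite_subset)
  let ?rot = "rotation U W' m"
  define R where "R = {u. \<exists>m1. ?rot m1 \<and> u \<in> U - m1 ` W'}"
  \<comment> \<open>A vertex \<open>w\<close> can lose its original partner \<open>m w\<close> only
    through a rotation that frees it, which puts \<open>m w\<close> into \<open>R\<close>.\<close>
  have inv: "matches_into G m1 W' U \<and> (\<forall>w\<in>W'. m1 w = m w \<or> m w \<in> R)" if "?rot m1" for m1
    using that
  proof induction
    case refl
    then show ?case using m by simp
  next
    case (step m1 u w)
    have into: "matches_into G (m1(w := u)) W' U"
      using matches_into_fun_upd[of m1 W' U u w] step by (simp add: insert_absorb)
    have "m1 w \<in> R"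
    proof -
      have "m1 w \<in> U" "m1 w \<notin> (m1(w := u)) ` W'"
        using step by (auto simp: matches_into_def inj_on_def)
      then show ?thesis using rotation.step[OF step(1-4)] unfolding R_def by blast
    qed
    then show ?case using into step.IH by (metis fun_upd_apply)
  qed
  define N where "N = {w \<in> W. \<exists>u\<in>R. w \<rightarrow> u}"
  \<comment> \<open>If \<open>w\<close> were outside \<open>W'\<close>, the free vertex
    \<open>u\<close> would allow an augmentation. So one can rotate at \<open>w\<close>, which frees
    its current partner; by \<open>inv\<close> the original partner is in \<open>R\<close> as
    well.\<close>
  have N: "w \<in> W' \<and> m w \<in> R" if wN: "w \<in> N" for w
  proof -
    obtain m1 u where u: "w \<in> W" "w \<rightarrow> u" "?rot m1" "u \<in> U - m1 ` W'"
      using wN by (auto simp: N_def R_def)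
    have "matches_into G (m1(w := u)) (insert w W') U"
      using matches_into_fun_upd[OF _ u(4,2)] inv[OF u(3)] by simp
    then have w: "w \<in> W'" using maximal u(1) by blast
    have "?rot (m1(w := u))" using rotation.step[OF u(3,4) w u(2)] .
    moreover have "m1 w \<in> U - (m1(w := u)) ` W'"
      using inv[OF u(3)] w u by (auto simp: matches_into_def inj_on_def)
    ultimately have "m1 w \<in> R" unfolding R_def by blast
    then show ?thesis using inv[OF u(3)] w by metis
  qed
  have RU: "R \<subseteq> U" by (auto simp: R_def)
  have sub: "U - m ` W' \<subseteq> R" using rotation.refl[of U W' m] by (auto simp: R_def)
  have injm: "inj_on m W'" and mU: "m ` W' \<subseteq> U" using m by (auto simp: matches_into_def)
  have NW: "N \<subseteq> W'" using N by blast
  have finR: "finite R" using RU fin(1) by (rule finite_subset)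
  have finW': "finite W'" using W' fin(2) by (rule finite_subset)
  have finN: "finite N" using NW finW' by (rule finite_subset)
  have "card (U - m ` W') + card (m ` N) = card ((U - m ` W') \<union> m ` N)"
    using fin finN NW by (intro card_Un_disjoint[symmetric]) auto
  also have "\<dots> \<le> card R"
    using finR sub N by (intro card_mono) auto
  finally have "card (U - m ` W') + card N \<le> card R"
    using injm NW by (simp add: card_image inj_on_subset)
  moreover have "card U = card (U - m ` W') + card W'"
    using card_Diff_subset[OF _ mU] card_mono[OF fin(1) mU] finW' injm by (simp add: card_image)
  ultimately have R: "card U + card N \<le> card R + card W'" by simp
  have "stable_set G (R \<union> (W - N))"
  proof (rule stable_setI)
    show "R \<union> (W - N) \<subseteq> verts G" using RU U W by blast
    have RN: "\<not> u \<rightarrow> w" "\<not> w \<rightarrow> u" if "u \<in> R" "w \<in> W - N" for u w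
      using that dominates_sym[of u w] by (auto simp: N_def)
    fix u v assume "u \<in> R \<union> (W - N)" "v \<in> R \<union> (W - N)"
    then consider "u \<in> R" "v \<in> R" | "u \<in> R" "v \<in> W - N" | "u \<in> W - N" "v \<in> R"
      | "u \<in> W - N" "v \<in> W - N"
      by blast
    then show "\<not> u \<rightarrow> v"
    proof cases
      case 1
      then show ?thesis using stableU RU by blast
    next
      case 4
      then show ?thesis using stableW by blast
    qed (rule RN, assumption+)+
  qed
  moreover have "card (R \<union> (W - N)) + card N = card R + card W"
  proof -
    have "card (R \<union> (W - N)) = card R + card (W - N)"
      using fin finR RU assms(3) by (intro card_Un_disjoint) auto
    moreover have "card (W - N) + card N = card W"
    proof -
      have "N \<subseteq> W" using NW W' by (rule subset_trans)
      then show ?thesis using card_Diff_subset[OF finN] card_mono[OF fin(2)] by simp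
    qed
    ultimately show ?thesis by simp
  qed
  ultimately show ?thesis using R by (intro exI[of _ "R \<union> (W - N)"] conjI) linarith+
qed

text \<open>An augmentation would add an edge to the maximum matching, so
  \<open>koenig_bipartition\<close> applies and its stable set bounds \<open>card S\<close> from
  below. The other inequality is \<open>card_matching_le\<close>.\<close>

theorem koenig:
  assumes "bipartite G" and M: "maximum_matching G M" and S: "maximum_stable_set G S"
  shows "card M = card (verts G - S)"
proof -
  obtain U W where UW: "verts G = U \<union> W" "U \<inter> W = {}"
    and adj: "\<And>u v. u \<rightarrow> v \<Longrightarrow> u \<in> U \<and> v \<in> W \<or> u \<in> W \<and> v \<in> U"
    using assms(1) unfolding bipartite_def by blast
  have matchM: "matching G M" using M by (simp add: maximum_matching_def)
  have fin: "finite U" "finite W" using UW(1) finite_verts by auto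
  define W' where "W' = W \<inter> \<Union>M"
  have ends: "\<exists>w u. e = {w, u} \<and> w \<in> W' \<and> u \<in> U" if e: "e \<in> M" for e
  proof -
    obtain u v where uv: "e = {u, v}" "u \<rightarrow> v"
      using e matchM by (auto simp: matching_def uedges_def)
    then show ?thesis using adj[OF uv(2)] e unfolding W'_def by blast
  qed
  have "W' \<inter> U = {}" using UW W'_def by blast
  moreover have "W' \<subseteq> \<Union>M" by (simp add: W'_def)
  ultimately obtain m where m: "matches_into G m W' U" "M = edges_of m W'"
    using matching_eq_edges_of[OF matchM ends] by metis
  have cardM: "card M = card W'" using matching_edges_of[OF m(1)] m(2) \<open>W' \<inter> U = {}\<close> by simp
  have maximal: "\<not> matches_into G m' (insert w W') U" if w: "w \<in> W - W'" for m' w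
  proof
    assume m': "matches_into G m' (insert w W') U"
    have "insert w W' \<inter> U = {}" using w UW \<open>W' \<inter> U = {}\<close> by blast
    note E = matching_edges_of[OF m' this]
    have "card (edges_of m' (insert w W')) = Suc (card W')"
      using E(2) w fin by (simp add: W'_def)
    then show False using M E(1) cardM unfolding maximum_matching_def
      by (metis Suc_n_not_le_n)
  qed
  have "\<exists>T. stable_set G T \<and> card U + card W \<le> card T + card W'"
  proof (rule koenig_bipartition[OF _ _ UW(2) _ _ _ m(1) maximal])
    show "\<not> u \<rightarrow> v" if "u \<in> U" "v \<in> U" for u v
      using adj[of u v] that UW(2) by blast
    show "\<not> u \<rightarrow> v" if "u \<in> W" "v \<in> W" for u v
      using adj[of u v] that UW(2) by blast
  qed (use UW(1) W'_def in auto)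
  then obtain T where T: "stable_set G T" "card U + card W \<le> card T + card W'" by blast
  have "card T \<le> card S" using S T(1) by (simp add: maximum_stable_set_def)
  then have "card U + card W \<le> card S + card M" using T(2) cardM by simp
  moreover have "card (verts G) = card U + card W"
    using UW fin by (simp add: card_Un_disjoint)
  moreover have "card (verts G - S) = card (verts G) - card S"
    using S finite_subset[OF _ finite_verts, of S]
    by (intro card_Diff_subset) (auto simp: maximum_stable_set_def stable_set_def)
  moreover have "card M \<le> card (verts G - S)"
    using card_matching_le S matchM by (simp add: maximum_stable_set_def)
  ultimately show ?thesis by linarith
qed

text \<open>By \<open>koenig\<close>, the injective choice of ends outside \<open>S\<close> exhausts
  \<open>verts G - S\<close>. An edge with both ends outside \<open>S\<close> would then have two
  distinct ends both equal to its chosen one.\<close>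

lemma maximum_matching_eq_edges_of:
  assumes "bipartite G" and M: "maximum_matching G M" and S: "maximum_stable_set G S"
  obtains p where "matches_into G p (verts G - S) S" "M = edges_of p (verts G - S)"
proof -
  have matchM: "matching G M" using M by (simp add: maximum_matching_def)
  have stable: "stable_set G S" using S by (simp add: maximum_stable_set_def)
  obtain g where g: "\<And>e. e \<in> M \<Longrightarrow> g e \<in> e" "inj_on g M" "g ` M \<subseteq> verts G - S"
    using choose_end_outside_stable[OF stable matchM] by metis
  have gM: "g ` M = verts G - S"
    using g koenig[OF assms] by (intro card_subset_eq) (auto simp: card_image)
  have eq: "v = g e" if v: "e \<in> M" "v \<in> e" "v \<in> verts G - S" for e v
  proof -
    obtain e' where "e' \<in> M" "v = g e'" using gM v(3) by blast
    then show ?thesis using g(1) matching_same_edge[OF matchM] v by metis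
  qed
  have ends: "\<exists>y s. e = {y, s} \<and> y \<in> verts G - S \<and> s \<in> S" if e: "e \<in> M" for e
  proof -
    obtain u v where uv: "e = {u, v}" "u \<rightarrow> v"
      using e matchM by (auto simp: matching_def uedges_def)
    have V: "u \<noteq> v" "u \<in> verts G" "v \<in> verts G" using uv dominates_neq adj_in_verts by auto
    have "u \<in> S \<or> v \<in> S"
    proof (rule ccontr)
      assume "\<not> ?thesis"
      then have "u = g e" "v = g e" using eq[OF e, of u] eq[OF e, of v] uv(1) V by simp_all
      then show False using V(1) by simp
    qed
    moreover have "g e \<in> {u, v}" using g(1)[OF e] uv(1) by simp
    moreover have "g e \<notin> S" using g(3) e by blast
    ultimately consider "u \<in> S" "v \<notin> S" | "v \<in> S" "u \<notin> S" by auto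
    then show ?thesis
    proof cases
      case 1
      then show ?thesis using uv(1) V by (intro exI[of _ v] exI[of _ u]) auto
    next
      case 2
      then show ?thesis using uv(1) V by (intro exI[of _ u] exI[of _ v]) auto
    qed
  qed
  have sat: "verts G - S \<subseteq> \<Union>M" unfolding gM[symmetric] using g(1) by blast
  show ?thesis
    by (rule matching_eq_edges_of[OF matchM ends _ sat]) (assumption, blast, rule that)
qed

section \<open>Accessibility chains\<close>

text \<open>A stable rival \<open>T\<close> injects into \<open>A\<close>: keep its vertices in
  \<open>S\<close> and send the others, which are neighbours of \<open>A\<close>, along
  \<open>p\<close>. A collision between the two kinds would need \<open>t = p t'\<close>, but then
  \<open>t\<close> and \<open>t'\<close> are adjacent.\<close>

lemma local_maximum_stable_setI:
  assumes S: "stable_set G S" and p: "matches_into G p (verts G - S) S"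
    and AS: "A \<subseteq> S" and closed: "\<And>x y. x \<in> A \<Longrightarrow> x \<rightarrow> y \<Longrightarrow> p y \<in> A"
  shows "A \<in> \<Psi> G"
proof -
  have AV: "A \<subseteq> verts G" using S AS by (auto simp: stable_set_def)
  have stableA: "stable_set (G \<restriction> closed_nbhd G A) A"
    using stable_setD[OF S] AS by (intro stable_set_induce_subgraphI) (auto simp: closed_nbhd_def)
  have "card T \<le> card A" if T: "stable_set (G \<restriction> closed_nbhd G A) T" for T
  proof -
    let ?h = "\<lambda>t. if t \<in> S then t else p t"
    have cases: "t \<in> A \<or> t \<in> verts G - S \<and> (\<exists>x\<in>A. x \<rightarrow> t)" if "t \<in> T" for t
      using that stable_set_induce_subgraphD(1)[OF T] stable_setD[OF S] AS
      by (auto simp: closed_nbhd_def nbhd_def)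
    have "?h ` T \<subseteq> A" using cases closed AS by auto
    moreover have "inj_on ?h T"
    proof
      fix t t' assume t: "t \<in> T" "t' \<in> T" "?h t = ?h t'"
      have "\<not> t \<rightarrow> t'" "\<not> t' \<rightarrow> t" using stable_set_induce_subgraphD(2)[OF T] t by auto
      then show "t = t'"
        using t cases[OF t(1)] cases[OF t(2)] AS p dominates_sym
        by (auto simp: matches_into_def split: if_splits dest: inj_onD)
    qed
    ultimately show ?thesis
      using AV by (intro card_inj_on_le[of ?h]) (auto intro: finite_subset)
  qed
  then show ?thesis
    using AV stableA by (auto simp: local_maximum_stable_sets_def maximum_stable_set_def)
qed

lemma alternating_cycle_not_uniquely_restricted:
  assumes S: "stable_set G S" and p: "matches_into G p (verts G - S) S"
    and C: "C \<subseteq> S" "C \<noteq> {}"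
    and out: "\<And>x. x \<in> C \<Longrightarrow> \<exists>y. x \<rightarrow> y \<and> p y \<in> C \<and> p y \<noteq> x"
  shows "\<not> uniquely_restricted G (edges_of p (verts G - S))"
proof
  let ?Y = "verts G - S"
  assume ur: "uniquely_restricted G (edges_of p ?Y)"
  have SV: "S \<subseteq> verts G" using S by (simp add: stable_set_def)
  obtain q where q: "\<And>x. x \<in> C \<Longrightarrow> x \<rightarrow> q x" "\<And>x. x \<in> C \<Longrightarrow> p (q x) \<in> C"
    "\<And>x. x \<in> C \<Longrightarrow> p (q x) \<noteq> x"
    using out by metis
  have "finite C" using finite_subset[OF subset_trans[OF C(1) SV]] by simp
  moreover have "(\<lambda>x. p (q x)) ` C \<subseteq> C" using q(2) by auto
  ultimately obtain D where D: "D \<subseteq> C" "D \<noteq> {}" "(\<lambda>x. p (q x)) ` D = D"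
    using finite_invariant_subset[OF _ C(2)] by metis
  have finD: "finite D" using D(1) \<open>finite C\<close> by (rule finite_subset)
  have inj: "inj_on (\<lambda>x. p (q x)) D" using finD D(3) by (simp add: eq_card_imp_inj_on)
  then have injq: "inj_on q D" by (simp add: inj_on_def)
  have pqD: "p (q x) \<in> D" if "x \<in> D" for x
    using imageI[OF that, of "\<lambda>x. p (q x)"] unfolding D(3) .
  have pqE: "\<exists>x\<in>D. z = p (q x)" if "z \<in> D" for z
  proof -
    have "z \<in> (\<lambda>x. p (q x)) ` D" unfolding D(3) by fact
    then show ?thesis by (simp add: image_iff)
  qed
  have qY: "q x \<in> ?Y" if "x \<in> D" for x
  proof -
    have "x \<in> S" "x \<rightarrow> q x" using that D(1) C(1) q(1) by auto
    then show ?thesis using stable_setD[OF S, of x "q x"] adj_in_verts(2) by auto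
  qed
  have injp: "inj_on p ?Y" and pS: "p ` ?Y \<subseteq> S" and padj: "\<And>y. y \<in> ?Y \<Longrightarrow> y \<rightarrow> p y"
    using p by (auto simp: matches_into_def)
  have qD: "y \<in> q ` D \<longleftrightarrow> p y \<in> D" if y: "y \<in> ?Y" for y
  proof
    assume "y \<in> q ` D"
    then show "p y \<in> D" using pqD by auto
  next
    assume "p y \<in> D"
    then obtain x where x: "x \<in> D" "p y = p (q x)" using pqE by blast
    then have "y = q x" using inj_onD[OF injp _ y qY[of x]] by simp
    then show "y \<in> q ` D" using x(1) by simp
  qed
  define p' where "p' y = (if y \<in> q ` D then inv_into D q y else p y)" for y
  have p'q: "p' (q x) = x" if "x \<in> D" for x
    using that injq by (simp add: p'_def)
  have p'p: "p' y = p y" if "y \<notin> q ` D" for y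
    using that by (simp add: p'_def)
  have inD: "p' y \<in> D \<longleftrightarrow> y \<in> q ` D" if y: "y \<in> ?Y" for y
  proof (cases "y \<in> q ` D")
    case True
    then show ?thesis using p'q by auto
  next
    case False
    then show ?thesis using qD[OF y] p'p by simp
  qed
  have inj': "inj_on p' ?Y"
  proof
    fix y y' assume y: "y \<in> ?Y" "y' \<in> ?Y" "p' y = p' y'"
    show "y = y'"
    proof (cases "y \<in> q ` D")
      case True
      then have "y' \<in> q ` D" using inD[OF y(1)] inD[OF y(2)] y(3) by simp
      then show ?thesis using True y(3) p'q by auto
    next
      case False
      then have "y' \<notin> q ` D" using inD[OF y(1)] inD[OF y(2)] y(3) by simp
      then show ?thesis using False y p'p inj_onD[OF injp] by simp
    qed
  qed
  moreover have im: "p' ` ?Y = p ` ?Y"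
  proof (rule card_subset_eq)
    show "p' ` ?Y \<subseteq> p ` ?Y"
    proof
      fix s assume "s \<in> p' ` ?Y"
      then obtain y where y: "y \<in> ?Y" "s = p' y" by (rule imageE)
      show "s \<in> p ` ?Y"
      proof (cases "y \<in> q ` D")
        case True
        then have "s \<in> D" using y inD by simp
        then obtain x where "x \<in> D" "s = p (q x)" using pqE by blast
        then show ?thesis using qY[of x] by simp
      next
        case False
        then show ?thesis using y p'p by simp
      qed
    qed
    show "card (p' ` ?Y) = card (p ` ?Y)" using inj' injp by (simp add: card_image)
  qed simp
  moreover have "y \<rightarrow> p' y" if "y \<in> ?Y" for y
  proof (cases "y \<in> q ` D")
    case True
    then obtain x where "x \<in> D" "y = q x" by blast
    then show ?thesis using p'q q(1)[of x] D(1) dominates_sym by auto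
  next
    case False
    then show ?thesis using p'p padj[OF that] by simp
  qed
  ultimately have "matches_into G p' ?Y S" using pS by (simp add: matches_into_def)
  then have "matching G (edges_of p' ?Y)" by (rule matching_edges_of) blast
  moreover have "\<Union>(edges_of p' ?Y) = \<Union>(edges_of p ?Y)" unfolding Union_edges_of im ..
  ultimately have eq: "edges_of p' ?Y = edges_of p ?Y"
    using ur by (simp add: uniquely_restricted_iff)
  obtain x where x: "x \<in> D" using D(2) by blast
  then have "{q x, x} \<in> edges_of p' ?Y" using p'q qY by (intro image_eqI[of _ _ "q x"]) simp_all
  \<comment> \<open>Were the new edge at \<open>q x\<close> an old one, \<open>p (q x)\<close> would
    be \<open>x\<close>, a fixed point.\<close>
  then obtain y where y: "y \<in> ?Y" "{q x, x} = {y, p y}" unfolding eq by (rule imageE)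
  have "x \<in> S" using x D(1) C(1) by blast
  then have "x = p (q x)" using y by (auto simp: doubleton_eq_iff)
  then show False using q(3)[of x] x D(1) by auto
qed

lemma uniquely_restricted_imp_accessibility_chain:
  assumes "bipartite G" "maximum_matching G M" "uniquely_restricted G M"
    and S: "maximum_stable_set G S"
  shows "\<exists>xs. accessibility_chain G S xs"
proof -
  obtain p where p: "matches_into G p (verts G - S) S" and M: "M = edges_of p (verts G - S)"
    using maximum_matching_eq_edges_of[OF assms(1,2) S] by blast
  have stable: "stable_set G S" using S by (simp add: maximum_stable_set_def)
  then have "finite S" by (auto simp: stable_set_def intro: finite_subset)
  let ?r = "\<lambda>x z. \<exists>y. x \<rightarrow> y \<and> p y = z"
  \<comment> \<open>If this fails, every \<open>x\<close> in \<open>C\<close> has a neighbour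
    \<open>y\<close> with \<open>p y\<close> different from \<open>x\<close> and outside
    \<open>S - C\<close>. Since \<open>p y\<close> is in \<open>S\<close>, it lies in
    \<open>C\<close>, which yields an alternating cycle.\<close>
  have "\<exists>x\<in>C. \<forall>z. ?r x z \<longrightarrow> z \<in> insert x (S - C)" if C: "C \<subseteq> S" "C \<noteq> {}" for C
  proof (rule ccontr)
    assume neg: "\<not> ?thesis"
    have "\<exists>y. x \<rightarrow> y \<and> p y \<in> C \<and> p y \<noteq> x" if x: "x \<in> C" for x
    proof -
      obtain y where y: "x \<rightarrow> y" "p y \<notin> insert x (S - C)" using neg x by blast
      have "y \<in> verts G - S" using y(1) x C(1) stable_setD[OF stable] adj_in_verts by blast
      then have "p y \<in> S" using p by (auto simp: matches_into_def)
      then show ?thesis using y by blast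
    qed
    then show False
      using alternating_cycle_not_uniquely_restricted[OF stable p C] assms(3) M by blast
  qed
  then obtain xs where xs: "distinct xs" "set xs = S"
    "\<And>j x z. x \<in> set (take j xs) \<Longrightarrow> ?r x z \<Longrightarrow> z \<in> set (take j xs)"
    using closed_prefix_ordering[OF \<open>finite S\<close>, of ?r] by metis
  have "set (take j xs) \<in> \<Psi> G" for j
    using xs set_take_subset[of j xs] by (intro local_maximum_stable_setI[OF stable p]) blast+
  then show ?thesis using xs by (auto simp: accessibility_chain_def)
qed

section \<open>From an accessibility chain to a uniquely restricted maximum matching\<close>

text \<open>Two common neighbours of \<open>x\<close> lie on the same side, hence are not adjacent.\<close>

lemma new_neighbour_unique:
  assumes "bipartite G" and A: "insert x A \<in> \<Psi> G"
    and y: "x \<rightarrow> y" "\<And>a. a \<in> A \<Longrightarrow> \<not> a \<rightarrow> y"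
    and y': "x \<rightarrow> y'" "\<And>a. a \<in> A \<Longrightarrow> \<not> a \<rightarrow> y'"
  shows "y = y'"
proof (rule ccontr)
  assume "y \<noteq> y'"
  let ?H = "G \<restriction> closed_nbhd G (insert x A)"
  have V: "insert x A \<subseteq> verts G" and max: "maximum_stable_set ?H (insert x A)"
    using A by (auto simp: local_maximum_stable_sets_def)
  have stable: "stable_set ?H (insert x A)" using max by (simp add: maximum_stable_set_def)
  have fin: "finite A" using V by (auto intro: finite_subset)
  note noadj = stable_set_induce_subgraphD(2)[OF stable]
  have notin: "y \<notin> insert x A" "y' \<notin> insert x A" using noadj y(1) y'(1) by blast+
  have "\<not> y \<rightarrow> y'" "\<not> y' \<rightarrow> y"
    using assms(1) y(1) y'(1) unfolding bipartite_def by blast+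
  moreover have "\<not> y \<rightarrow> y" "\<not> y' \<rightarrow> y'" using dominates_neq by blast+
  \<comment> \<open>Trading \<open>x\<close> for both \<open>y\<close> and \<open>y'\<close> would
    enlarge the stable set.\<close>
  ultimately have "stable_set ?H (insert y (insert y' A))"
    using y y' notin noadj dominates_sym[of y] dominates_sym[of y'] adj_in_verts
    by (intro stable_set_induce_subgraphI) (auto simp: closed_nbhd_def nbhd_def)
  then have "card (insert y (insert y' A)) \<le> card (insert x A)"
    using max by (simp add: maximum_stable_set_def)
  moreover have "card (insert y (insert y' A)) = Suc (Suc (card A))"
    using notin \<open>y \<noteq> y'\<close> fin by simp
  moreover have "card (insert x A) \<le> Suc (card A)" by (rule card_insert_le_m1) auto
  ultimately show False by simp
qed

lemma maximum_stable_set_dominates: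
  assumes S: "maximum_stable_set G S" and y: "y \<in> verts G - S"
  shows "\<exists>x\<in>S. x \<rightarrow> y"
proof (rule ccontr)
  assume neg: "\<not> ?thesis"
  have stable: "stable_set G S" using S by (simp add: maximum_stable_set_def)
  have "stable_set G (insert y S)"
    using stable y neg stable_setD[OF stable] dominates_neq[of y y] dominates_sym[of y]
    by (intro stable_setI) (auto simp: stable_set_def)
  then have "card (insert y S) \<le> card S" using S by (simp add: maximum_stable_set_def)
  moreover have "finite S" using stable by (auto simp: stable_set_def intro: finite_subset)
  ultimately show False using y by simp
qed

lemma accessibility_chain_imp_uniquely_restricted:
  assumes "bipartite G" and S: "maximum_stable_set G S" and chain: "accessibility_chain G S xs"
  shows "\<exists>M. maximum_matching G M \<and> uniquely_restricted G M"
proof -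
  let ?Y = "verts G - S"
  have stable: "stable_set G S" using S by (simp add: maximum_stable_set_def)
  have xs: "distinct xs" "set xs = S" "\<And>j. j \<in> {1..length xs} \<Longrightarrow> set (take j xs) \<in> \<Psi> G"
    using chain by (auto simp: accessibility_chain_def)
  define k where "k y = (LEAST i. i < length xs \<and> xs ! i \<rightarrow> y)" for y
  define p where "p y = xs ! k y" for y
  have k: "k y < length xs" "p y \<rightarrow> y" if y: "y \<in> ?Y" for y
  proof -
    obtain i where "i < length xs \<and> xs ! i \<rightarrow> y"
      using maximum_stable_set_dominates[OF S y] xs(2) by (metis in_set_conv_nth)
    from LeastI[of "\<lambda>i. i < length xs \<and> xs ! i \<rightarrow> y", OF this]
    show "k y < length xs" "p y \<rightarrow> y" by (auto simp: k_def p_def)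
  qed
  have k_le: "k y \<le> i" if "i < length xs" "xs ! i \<rightarrow> y" for i y
    unfolding k_def using that by (intro Least_le) simp
  \<comment> \<open>With equal indices, \<open>y\<close> and \<open>y'\<close> both become
    neighbours of the chain at the same moment, against \<open>new_neighbour_unique\<close>.\<close>
  have k_eq: "y = y'" if y: "y \<in> ?Y" "y' \<in> ?Y" "k y = k y'" for y y'
  proof -
    let ?A = "set (take (k y) xs)"
    have *: "\<not> a \<rightarrow> z" if a: "a \<in> ?A" "k z = k y" for a z
    proof
      assume "a \<rightarrow> z"
      moreover obtain i where "i < k y" "i < length xs" "a = xs ! i"
        using a(1) by (auto simp: in_set_conv_nth)
      ultimately show False using k_le[of i z] a(2) by simp
    qed
    \<comment> \<open>Indices start at 0, so \<open>p y\<close> completes the prefix of length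
      \<open>Suc (k y)\<close>, a length in the range where the chain condition holds.\<close>
    have "insert (p y) ?A = set (take (Suc (k y)) xs)"
      using k(1)[OF y(1)] by (simp add: take_Suc_conv_app_nth p_def)
    then have "insert (p y) ?A \<in> \<Psi> G" using xs(3) k(1)[OF y(1)] by simp
    moreover have "p y' = p y" using y(3) by (simp add: p_def)
    ultimately show ?thesis
      using new_neighbour_unique[OF assms(1), of "p y" ?A y y'] k(2) y * by metis
  qed
  have pS: "p y \<in> S" if "y \<in> ?Y" for y
    using k(1)[OF that] xs(2) by (auto simp: p_def)
  have p_eq: "y = y'" if "y \<in> ?Y" "y' \<in> ?Y" "p y = p y'" for y y'
    using that k_eq k(1) xs(1) by (auto simp: p_def nth_eq_iff_index_eq)
  have p: "matches_into G p ?Y S"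
    using pS p_eq k(2) dominates_sym by (auto simp: matches_into_def inj_on_def)
  let ?M = "edges_of p ?Y"
  have M: "matching G ?M" "card ?M = card ?Y" using matching_edges_of[OF p] by auto
  have "M' = ?M" if M': "matching G M'" "\<Union>M' = \<Union>?M" for M'
  proof
    \<comment> \<open>Strong induction along the chain: the partner \<open>z\<close> of
      \<open>p y\<close> in \<open>M'\<close> satisfies \<open>k z \<le> k y\<close>. If strictly,
      \<open>z\<close> is already matched with \<open>p z\<close>, so \<open>p z = p y\<close> and
      injectivity gives \<open>z = y\<close>; if equal, \<open>k_eq\<close> does.\<close>
    have sub: "{y, p y} \<in> M'" if "y \<in> ?Y" for y
      using that
    proof (induction "k y" arbitrary: y rule: less_induct)
      case less
      have "p y \<in> \<Union>?M" using less.prems by blast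
      then obtain e where e: "e \<in> M'" "p y \<in> e" using M'(2) by blast
      then obtain z where z: "e = {z, p y}"
        using M'(1) by (auto simp: matching_def uedges_def)
      then have adj: "p y \<rightarrow> z"
        using e(1) M'(1) uedges_iff dominates_sym by (auto simp: matching_def)
      have zY: "z \<in> ?Y" using adj pS[OF less.prems] stable_setD[OF stable] adj_in_verts by blast
      have "k z \<le> k y" using k_le[OF k(1)[OF less.prems]] adj by (simp add: p_def)
      have "z = y"
      proof (cases "k z = k y")
        case True
        then show ?thesis using k_eq[OF zY less.prems] by blast
      next
        case False
        then have "{z, p z} \<in> M'" using less.hyps zY \<open>k z \<le> k y\<close> by simp
        then have "{z, p z} = {z, p y}" using matching_same_edge[OF M'(1) _ e(1)] z by blast
        then have "p z = p y" by (auto simp: doubleton_eq_iff)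
        then show ?thesis using p_eq[OF zY less.prems] by blast
      qed
      then show ?case using e(1) z by simp
    qed
    then show "?M \<subseteq> M'" by blast
    show "M' \<subseteq> ?M"
    proof
      fix e assume e: "e \<in> M'"
      then obtain v where v: "v \<in> e" using M'(1) by (auto simp: matching_def uedges_def)
      then obtain y where "y \<in> ?Y" "v \<in> {y, p y}" using M'(2) e by blast
      then show "e \<in> ?M" using sub matching_same_edge[OF M'(1) e _ v] by blast
    qed
  qed
  then have "uniquely_restricted G ?M" using M(1) by (simp add: uniquely_restricted_iff)
  \<comment> \<open>The matching attains the bound of \<open>card_matching_le\<close>.\<close>
  moreover have "maximum_matching G ?M"
    using M card_matching_le[OF stable] by (simp add: maximum_matching_def)
  ultimately show ?thesis by blast
qed

text \<open>Keeps (iii) from holding vacuously, so that (iii) implies (i).\<close>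

lemma maximum_stable_set_exists: "\<exists>S. maximum_stable_set G S"
proof -
  have "stable_set G {}" by (simp add: stable_set_def)
  moreover have "card T < Suc (card (verts G))" if "stable_set G T" for T
    using that by (simp add: stable_set_def card_mono less_Suc_eq_le)
  ultimately have "\<exists>S. stable_set G S \<and> (\<forall>T. stable_set G T \<longrightarrow> card T \<le> card S)"
    using ex_has_greatest_nat[of "stable_set G" "{}" card "Suc (card (verts G))"] by blast
  then show ?thesis by (simp add: maximum_stable_set_def)
qed

end

theorem theorem3:
  fixes G :: "('a, 'b) pre_digraph"
  assumes "graph G" and "bipartite G"
  shows "((\<exists>S. maximum_stable_set G S \<and> (\<exists>xs. accessibility_chain G S xs)) \<longleftrightarrow>
          (\<exists>M. maximum_matching G M \<and> uniquely_restricted G M)) \<and>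
         ((\<exists>M. maximum_matching G M \<and> uniquely_restricted G M) \<longleftrightarrow>
          (\<forall>S. maximum_stable_set G S \<longrightarrow> (\<exists>xs. accessibility_chain G S xs)))"
proof -
  interpret graph G by fact
  show ?thesis
    using accessibility_chain_imp_uniquely_restricted[OF assms(2)]
      uniquely_restricted_imp_accessibility_chain[OF assms(2)] maximum_stable_set_exists
    by blast
qed

end
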